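(* Let $A$ be a commutative ring. Let $n$ be a positive integer, let $\Lambda\subseteq \mathbb{Q}^n$ be an additive submonoid, and let $R=A[\Lambda]$ be the monoid algebra of $\Lambda$ over $A$. If $\Lambda$ is not a group, then $R$ is not an Egyptian ring.
   Context: Rings are commutative with identity. A regular element of a ring is an element that is not a zero-divisor. For a multiplicative set $W\subseteq R$, $W^{-1}R$ denotes the localization. A ring $R$ is Egyptian if, with $W$ the multiplicative set of all regular elements of $R$, for every nonzero $b\in R$ the element $\frac{b}{1}\in W^{-1}R$ can be written as a finite (possibly empty) sum of reciprocals $\frac{1}{w_1}+\cdots+\frac{1}{w_m}$ with all $w_i\in W$ (repetitions allowed).
   Formalization: The commutative ring A is assumed to be nonzero; for A = 0 the monoid algebra A[Λ] is the zero ring, which is vacuously Egyptian, so the claim fails there (e.g. for Λ the natural numbers). *)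

theory Defs
  imports "HOL-Analysis.Finite_Cartesian_Product" "HOL-Library.Poly_Mapping" "HOL-Algebra.Ring"
begin

section \<open>Regular elements and localization\<close>

definition regular_elements :: "('a, 'm) ring_scheme \<Rightarrow> 'a set" where
  "regular_elements R =
     {r \<in> carrier R. \<forall>z\<in>carrier R. r \<otimes>\<^bsub>R\<^esub> z = \<zero>\<^bsub>R\<^esub> \<longrightarrow> z = \<zero>\<^bsub>R\<^esub>}"

definition frac_rel :: "('a, 'm) ring_scheme \<Rightarrow> 'a set \<Rightarrow> (('a \<times> 'a) \<times> ('a \<times> 'a)) set" where
  "frac_rel R W =
     {((r, s), (r', s')). r \<in> carrier R \<and> r' \<in> carrier R \<and> s \<in> W \<and> s' \<in> W \<and>
        (\<exists>t\<in>W. t \<otimes>\<^bsub>R\<^esub> (r \<otimes>\<^bsub>R\<^esub> s') = t \<otimes>\<^bsub>R\<^esub> (r' \<otimes>\<^bsub>R\<^esub> s))}"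

definition loc_frac :: "('a, 'm) ring_scheme \<Rightarrow> 'a set \<Rightarrow> 'a \<Rightarrow> 'a \<Rightarrow> ('a \<times> 'a) set" where
  "loc_frac R W r s = frac_rel R W `` {(r, s)}"

text \<open>The unions over representatives below are unions of copies of one and the same class.\<close>

definition localization :: "('a, 'm) ring_scheme \<Rightarrow> 'a set \<Rightarrow> ('a \<times> 'a) set ring" where
  "localization R W =
     \<lparr>carrier = (carrier R \<times> W) // frac_rel R W,
      mult = (\<lambda>X Y. \<Union>(r, s)\<in>X. \<Union>(r', s')\<in>Y. loc_frac R W (r \<otimes>\<^bsub>R\<^esub> r') (s \<otimes>\<^bsub>R\<^esub> s')),
      one = loc_frac R W \<one>\<^bsub>R\<^esub> \<one>\<^bsub>R\<^esub>,
      zero = loc_frac R W \<zero>\<^bsub>R\<^esub> \<one>\<^bsub>R\<^esub>,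
      add = (\<lambda>X Y. \<Union>(r, s)\<in>X. \<Union>(r', s')\<in>Y.
               loc_frac R W (r \<otimes>\<^bsub>R\<^esub> s' \<oplus>\<^bsub>R\<^esub> r' \<otimes>\<^bsub>R\<^esub> s) (s \<otimes>\<^bsub>R\<^esub> s'))\<rparr>"

locale ring_localization = cring R + submonoid W R for R (structure) and W
begin

lemma W_carrier [simp, intro]: "s \<in> W \<Longrightarrow> s \<in> carrier R"
  using subset by blast

lemma equiv_frac_rel: "equiv (carrier R \<times> W) (frac_rel R W)"
proof (rule equivI)
  show "frac_rel R W \<subseteq> (carrier R \<times> W) \<times> (carrier R \<times> W)"
    by (auto simp: frac_rel_def)
  show "refl_on (carrier R \<times> W) (frac_rel R W)"
    by (auto simp: refl_on_def frac_rel_def intro: one_closed)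
  show "sym (frac_rel R W)"
    unfolding sym_def frac_rel_def by (auto; metis)
  show "trans (frac_rel R W)"
  proof (rule transI, clarify)
    fix a b c d e f
    assume 1: "((a, b), (c, d)) \<in> frac_rel R W" and 2: "((c, d), (e, f)) \<in> frac_rel R W"
    then have W: "b \<in> W" "d \<in> W" "f \<in> W" and C: "a \<in> carrier R" "c \<in> carrier R" "e \<in> carrier R"
      by (auto simp: frac_rel_def)
    from 1 obtain t where t: "t \<in> W" "t \<otimes> (a \<otimes> d) = t \<otimes> (c \<otimes> b)"
      by (auto simp: frac_rel_def)
    from 2 obtain u where u: "u \<in> W" "u \<otimes> (c \<otimes> f) = u \<otimes> (e \<otimes> d)"
      by (auto simp: frac_rel_def)
    note car = W_carrier[OF t(1)] W_carrier[OF u(1)] W_carrier[OF W(1)]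
      W_carrier[OF W(2)] W_carrier[OF W(3)] C
    have "t \<otimes> u \<otimes> d \<otimes> (a \<otimes> f) = u \<otimes> f \<otimes> (t \<otimes> (a \<otimes> d))"
      using car by (simp add: m_ac)
    also have "\<dots> = t \<otimes> b \<otimes> (u \<otimes> (c \<otimes> f))"
      unfolding t(2) using car by (simp add: m_ac)
    also have "\<dots> = t \<otimes> u \<otimes> d \<otimes> (e \<otimes> b)"
      unfolding u(2) using car by (simp add: m_ac)
    finally have "t \<otimes> u \<otimes> d \<otimes> (a \<otimes> f) = t \<otimes> u \<otimes> d \<otimes> (e \<otimes> b)" .
    moreover have "t \<otimes> u \<otimes> d \<in> W"
      using t(1) u(1) W by auto
    ultimately show "((a, b), (e, f)) \<in> frac_rel R W"
      using W C unfolding frac_rel_def by blast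
  qed
qed

lemma loc_frac_eq_iff:
  assumes "r \<in> carrier R" "s \<in> W" "r' \<in> carrier R" "s' \<in> W"
  shows "loc_frac R W r s = loc_frac R W r' s' \<longleftrightarrow> (\<exists>t\<in>W. t \<otimes> (r \<otimes> s') = t \<otimes> (r' \<otimes> s))"
  unfolding loc_frac_def
  using eq_equiv_class_iff[OF equiv_frac_rel, of "(r, s)" "(r', s')"] assms
  by (simp add: frac_rel_def)

lemma carrier_localization:
  "carrier (localization R W) = {loc_frac R W r s |r s. r \<in> carrier R \<and> s \<in> W}"
  by (auto simp: localization_def loc_frac_def quotient_def)

lemma loc_frac_closed [simp, intro]:
  "r \<in> carrier R \<Longrightarrow> s \<in> W \<Longrightarrow> loc_frac R W r s \<in> carrier (localization R W)"
  by (auto simp: carrier_localization)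

lemma zero_localization: "\<zero>\<^bsub>localization R W\<^esub> = loc_frac R W \<zero> \<one>"
  and one_localization: "\<one>\<^bsub>localization R W\<^esub> = loc_frac R W \<one> \<one>"
  by (simp_all add: localization_def)

lemma loc_frac_mult:
  assumes "r \<in> carrier R" "s \<in> W" "r' \<in> carrier R" "s' \<in> W"
  shows "loc_frac R W r s \<otimes>\<^bsub>localization R W\<^esub> loc_frac R W r' s' = loc_frac R W (r \<otimes> r') (s \<otimes> s')"
proof -
  have "(\<lambda>p q. case p of (r, s) \<Rightarrow> case q of (r', s') \<Rightarrow> loc_frac R W (r \<otimes> r') (s \<otimes> s'))
          respects2 (frac_rel R W)"
  proof (rule congruent2_commuteI[OF equiv_frac_rel], goal_cases)
    case (1 y z)
    then show ?case by (auto simp: m_comm)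
  next
    case (2 y z w)
    obtain a b c d e f where [simp]: "y = (a, b)" "z = (c, d)" "w = (e, f)"
      by (metis surj_pair)
    from 2 have W: "b \<in> W" "d \<in> W" "f \<in> W" and C: "a \<in> carrier R" "c \<in> carrier R" "e \<in> carrier R"
      by (auto simp: frac_rel_def)
    from 2 obtain t where t: "t \<in> W" "t \<otimes> (a \<otimes> d) = t \<otimes> (c \<otimes> b)"
      by (auto simp: frac_rel_def)
    note car = W_carrier[OF t(1)] W_carrier[OF W(1)] W_carrier[OF W(2)] W_carrier[OF W(3)] C
    have "t \<otimes> (e \<otimes> a \<otimes> (f \<otimes> d)) = e \<otimes> f \<otimes> (t \<otimes> (a \<otimes> d))"
      using car by (simp add: m_ac)
    also have "\<dots> = t \<otimes> (e \<otimes> c \<otimes> (f \<otimes> b))"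
      unfolding t(2) using car by (simp add: m_ac)
    finally have eq: "t \<otimes> (e \<otimes> a \<otimes> (f \<otimes> d)) = t \<otimes> (e \<otimes> c \<otimes> (f \<otimes> b))" .
    have "loc_frac R W (e \<otimes> a) (f \<otimes> b) = loc_frac R W (e \<otimes> c) (f \<otimes> d)"
      by (subst loc_frac_eq_iff) (use W C t(1) eq in auto)
    then show ?case by simp
  qed
  from UN_equiv_class2[OF equiv_frac_rel equiv_frac_rel this, of "(r, s)" "(r', s')"] assms
  show ?thesis by (simp add: localization_def loc_frac_def[of R W r s] loc_frac_def[of R W r' s'] split_def)
qed

lemma loc_frac_add:
  assumes "r \<in> carrier R" "s \<in> W" "r' \<in> carrier R" "s' \<in> W"
  shows "loc_frac R W r s \<oplus>\<^bsub>localization R W\<^esub> loc_frac R W r' s' =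
         loc_frac R W (r \<otimes> s' \<oplus> r' \<otimes> s) (s \<otimes> s')"
proof -
  have "(\<lambda>p q. case p of (r, s) \<Rightarrow> case q of (r', s') \<Rightarrow> loc_frac R W (r \<otimes> s' \<oplus> r' \<otimes> s) (s \<otimes> s'))
          respects2 (frac_rel R W)"
  proof (rule congruent2_commuteI[OF equiv_frac_rel], goal_cases)
    case (1 y z)
    then show ?case by (auto simp: m_comm a_comm)
  next
    case (2 y z w)
    obtain a b c d e f where [simp]: "y = (a, b)" "z = (c, d)" "w = (e, f)"
      by (metis surj_pair)
    from 2 have W: "b \<in> W" "d \<in> W" "f \<in> W" and C: "a \<in> carrier R" "c \<in> carrier R" "e \<in> carrier R"
      by (auto simp: frac_rel_def)
    from 2 obtain t where t: "t \<in> W" "t \<otimes> (a \<otimes> d) = t \<otimes> (c \<otimes> b)"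
      by (auto simp: frac_rel_def)
    note car = W_carrier[OF t(1)] W_carrier[OF W(1)] W_carrier[OF W(2)] W_carrier[OF W(3)] C
    have "t \<otimes> ((e \<otimes> b \<oplus> a \<otimes> f) \<otimes> (f \<otimes> d)) =
          t \<otimes> e \<otimes> b \<otimes> f \<otimes> d \<oplus> f \<otimes> f \<otimes> (t \<otimes> (a \<otimes> d))"
      using car by (simp add: m_ac l_distr r_distr)
    also have "\<dots> = t \<otimes> ((e \<otimes> d \<oplus> c \<otimes> f) \<otimes> (f \<otimes> b))"
      unfolding t(2) using car by (simp add: m_ac l_distr r_distr)
    finally have eq: "t \<otimes> ((e \<otimes> b \<oplus> a \<otimes> f) \<otimes> (f \<otimes> d)) = t \<otimes> ((e \<otimes> d \<oplus> c \<otimes> f) \<otimes> (f \<otimes> b))" .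
    have "loc_frac R W (e \<otimes> b \<oplus> a \<otimes> f) (f \<otimes> b) = loc_frac R W (e \<otimes> d \<oplus> c \<otimes> f) (f \<otimes> d)"
      by (subst loc_frac_eq_iff) (use W C t(1) eq in auto)
    then show ?case by simp
  qed
  from UN_equiv_class2[OF equiv_frac_rel equiv_frac_rel this, of "(r, s)" "(r', s')"] assms
  show ?thesis by (simp add: localization_def loc_frac_def[of R W r s] loc_frac_def[of R W r' s'] split_def)
qed

lemma loc_frac_eqI:
  assumes "r \<in> carrier R" "s \<in> W" "r' \<in> carrier R" "s' \<in> W" "r \<otimes> s' = r' \<otimes> s"
  shows "loc_frac R W r s = loc_frac R W r' s'"
  using assms one_closed by (subst loc_frac_eq_iff) auto

lemma cring_localization: "cring (localization R W)"
proof (rule cringI)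
  let ?L = "localization R W"
  note [simp] = loc_frac_mult loc_frac_add zero_localization one_localization
  have E: thesis if "x \<in> carrier ?L"
    "\<And>r s. x = loc_frac R W r s \<Longrightarrow> r \<in> carrier R \<Longrightarrow> s \<in> W \<Longrightarrow> thesis" for x thesis
    using that by (auto simp: carrier_localization)
  show "abelian_group ?L"
  proof (rule abelian_groupI)
    fix x y z assume "x \<in> carrier ?L" "y \<in> carrier ?L" "z \<in> carrier ?L"
    then obtain a b c d e f where x: "x = loc_frac R W a b" "a \<in> carrier R" "b \<in> W"
      and y: "y = loc_frac R W c d" "c \<in> carrier R" "d \<in> W"
      and z: "z = loc_frac R W e f" "e \<in> carrier R" "f \<in> W"
      by (elim E) blast
    have "(a \<otimes> d \<oplus> c \<otimes> b) \<otimes> f \<oplus> e \<otimes> (b \<otimes> d) = a \<otimes> (d \<otimes> f) \<oplus> (c \<otimes> f \<oplus> e \<otimes> d) \<otimes> b"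
      using x(2,3) y(2,3) z(2,3) by (simp add: l_distr r_distr m_ac a_ac)
    then show "x \<oplus>\<^bsub>?L\<^esub> y \<oplus>\<^bsub>?L\<^esub> z = x \<oplus>\<^bsub>?L\<^esub> (y \<oplus>\<^bsub>?L\<^esub> z)"
      using x y z by (simp add: m_assoc)
  next
    fix x y assume "x \<in> carrier ?L" "y \<in> carrier ?L"
    then show "x \<oplus>\<^bsub>?L\<^esub> y \<in> carrier ?L"
      by (elim E) simp
  next
    fix x y assume "x \<in> carrier ?L" "y \<in> carrier ?L"
    then show "x \<oplus>\<^bsub>?L\<^esub> y = y \<oplus>\<^bsub>?L\<^esub> x"
      by (elim E) (simp add: m_comm a_comm)
  next
    fix x assume "x \<in> carrier ?L"
    then show "\<zero>\<^bsub>?L\<^esub> \<oplus>\<^bsub>?L\<^esub> x = x"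
      by (elim E) simp
  next
    fix x assume "x \<in> carrier ?L"
    then obtain r s where x: "x = loc_frac R W r s" "r \<in> carrier R" "s \<in> W"
      by (rule E)
    have "\<ominus> r \<otimes> s \<oplus> r \<otimes> s = \<zero>"
      using x by (simp add: l_minus l_neg)
    then have "loc_frac R W (\<ominus> r) s \<oplus>\<^bsub>?L\<^esub> x = \<zero>\<^bsub>?L\<^esub>"
      using x by (simp, intro loc_frac_eqI) simp_all
    then show "\<exists>y\<in>carrier ?L. y \<oplus>\<^bsub>?L\<^esub> x = \<zero>\<^bsub>?L\<^esub>"
      using x by (intro bexI[of _ "loc_frac R W (\<ominus> r) s"]) auto
  qed simp
  show "comm_monoid ?L"
  proof (rule comm_monoidI)
    fix x y assume "x \<in> carrier ?L" "y \<in> carrier ?L"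
    then show "x \<otimes>\<^bsub>?L\<^esub> y \<in> carrier ?L" "x \<otimes>\<^bsub>?L\<^esub> y = y \<otimes>\<^bsub>?L\<^esub> x"
      by (elim E, simp add: m_comm)+
  next
    fix x y z assume "x \<in> carrier ?L" "y \<in> carrier ?L" "z \<in> carrier ?L"
    then show "x \<otimes>\<^bsub>?L\<^esub> y \<otimes>\<^bsub>?L\<^esub> z = x \<otimes>\<^bsub>?L\<^esub> (y \<otimes>\<^bsub>?L\<^esub> z)"
      by (elim E) (simp add: m_assoc)
  next
    fix x assume "x \<in> carrier ?L"
    then show "\<one>\<^bsub>?L\<^esub> \<otimes>\<^bsub>?L\<^esub> x = x"
      by (elim E) simp
  qed simp
  fix x y z assume "x \<in> carrier ?L" "y \<in> carrier ?L" "z \<in> carrier ?L"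
  then obtain a b c d e f where x: "x = loc_frac R W a b" "a \<in> carrier R" "b \<in> W"
    and y: "y = loc_frac R W c d" "c \<in> carrier R" "d \<in> W"
    and z: "z = loc_frac R W e f" "e \<in> carrier R" "f \<in> W"
    by (elim E) blast
  define p where "p = a \<otimes> d \<oplus> c \<otimes> b"
  have p: "p \<in> carrier R"
    using x y by (simp add: p_def)
  have "a \<otimes> e \<otimes> (d \<otimes> f) \<oplus> c \<otimes> e \<otimes> (b \<otimes> f) = a \<otimes> d \<otimes> (e \<otimes> f) \<oplus> c \<otimes> b \<otimes> (e \<otimes> f)"
    using x(2,3) y(2,3) z(2,3) by (simp add: m_ac)
  also have "\<dots> = p \<otimes> (e \<otimes> f)"
    unfolding p_def using x(2,3) y(2,3) z(2,3) by (simp add: l_distr)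
  finally have num: "a \<otimes> e \<otimes> (d \<otimes> f) \<oplus> c \<otimes> e \<otimes> (b \<otimes> f) = p \<otimes> (e \<otimes> f)" .
  have "x \<otimes>\<^bsub>?L\<^esub> z \<oplus>\<^bsub>?L\<^esub> y \<otimes>\<^bsub>?L\<^esub> z = loc_frac R W (p \<otimes> (e \<otimes> f)) (b \<otimes> f \<otimes> (d \<otimes> f))"
    using x y z by (simp add: num)
  also have "\<dots> = loc_frac R W (p \<otimes> e) (b \<otimes> d \<otimes> f)"
    using p x(2,3) y(2,3) z(2,3) by (intro loc_frac_eqI) (simp_all add: m_ac)
  also have "\<dots> = (x \<oplus>\<^bsub>?L\<^esub> y) \<otimes>\<^bsub>?L\<^esub> z"
    using x y z by (simp add: p_def)
  finally show "(x \<oplus>\<^bsub>?L\<^esub> y) \<otimes>\<^bsub>?L\<^esub> z = x \<otimes>\<^bsub>?L\<^esub> z \<oplus>\<^bsub>?L\<^esub> y \<otimes>\<^bsub>?L\<^esub> z" ..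
qed

end

lemma (in cring) ring_localization_regular: "ring_localization R (regular_elements R)"
proof unfold_locales
  show "regular_elements R \<subseteq> carrier R" "\<one> \<in> regular_elements R"
    by (auto simp: regular_elements_def)
  show "x \<otimes> y \<in> regular_elements R" if "x \<in> regular_elements R" "y \<in> regular_elements R" for x y
    unfolding regular_elements_def
  proof (intro CollectI conjI ballI impI)
    have xy: "x \<in> carrier R" "y \<in> carrier R"
      using that by (auto simp: regular_elements_def)
    then show "x \<otimes> y \<in> carrier R" by simp
    fix z assume z: "z \<in> carrier R" "x \<otimes> y \<otimes> z = \<zero>"
    then have "x \<otimes> (y \<otimes> z) = \<zero>"
      using xy by (simp add: m_assoc)
    then have "y \<otimes> z = \<zero>"
      using that(1) xy z(1) by (auto simp: regular_elements_def)
    then show "z = \<zero>"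
      using that(2) z(1) by (auto simp: regular_elements_def)
  qed
qed


section \<open>Egyptian rings\<close>

definition Egyptian_ring :: "('a, 'm) ring_scheme \<Rightarrow> bool" where
  "Egyptian_ring R \<longleftrightarrow>
     (let W = regular_elements R in
      \<forall>b \<in> carrier R - {\<zero>\<^bsub>R\<^esub>}. \<exists>(m::nat) (w::nat \<Rightarrow> 'a). (\<forall>i<m. w i \<in> W) \<and>
        loc_frac R W b \<one>\<^bsub>R\<^esub> = (\<Oplus>\<^bsub>localization R W\<^esub> i\<in>{..<m}. loc_frac R W \<one>\<^bsub>R\<^esub> (w i)))"


section \<open>Monoid algebras\<close>

definition additive_monoid :: "'g::comm_monoid_add set \<Rightarrow> 'g monoid" where
  "additive_monoid S = \<lparr>carrier = S, mult = (+), one = 0\<rparr>"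

text \<open>
  The type \<open>'g \<Rightarrow>\<^sub>0 'a\<close> of finitely supported functions, with the convolution product, is the
  monoid algebra of all of \<open>'g\<close> over \<open>'a\<close>. The monoid algebra of a submonoid \<open>S\<close> consists of
  the functions supported in \<open>S\<close>.
\<close>

definition monoid_algebra :: "'g::comm_monoid_add set \<Rightarrow> ('g \<Rightarrow>\<^sub>0 'a::comm_ring_1) ring" where
  "monoid_algebra S =
     \<lparr>carrier = {f. Poly_Mapping.keys f \<subseteq> S}, mult = (*), one = 1, zero = 0, add = (+)\<rparr>"

lemma cring_monoid_algebra:
  fixes S :: "'g::comm_monoid_add set"
  assumes "submonoid S (additive_monoid UNIV)"
  shows "cring (monoid_algebra S :: ('g \<Rightarrow>\<^sub>0 'a::comm_ring_1) ring)"
proof -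
  have S: "0 \<in> S" "\<And>x y. x \<in> S \<Longrightarrow> y \<in> S \<Longrightarrow> x + y \<in> S"
    using submonoid.one_closed[OF assms] submonoid.m_closed[OF assms]
    by (auto simp: additive_monoid_def)
  have mult: "Poly_Mapping.keys (f * g) \<subseteq> S"
    if "Poly_Mapping.keys f \<subseteq> S" "Poly_Mapping.keys g \<subseteq> S" for f g :: "'g \<Rightarrow>\<^sub>0 'a"
    using keys_mult[of f g] that S(2) by fastforce
  have add: "Poly_Mapping.keys (f + g) \<subseteq> S"
    if "Poly_Mapping.keys f \<subseteq> S" "Poly_Mapping.keys g \<subseteq> S" for f g :: "'g \<Rightarrow>\<^sub>0 'a"
    using Poly_Mapping.keys_add[of f g] that by blast
  show ?thesis
  proof (rule cringI)
    show "abelian_group (monoid_algebra S :: ('g \<Rightarrow>\<^sub>0 'a) ring)"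
    proof (rule abelian_groupI)
      fix x :: "'g \<Rightarrow>\<^sub>0 'a" assume "x \<in> carrier (monoid_algebra S)"
      then show "\<exists>y\<in>carrier (monoid_algebra S). y \<oplus>\<^bsub>monoid_algebra S\<^esub> x = \<zero>\<^bsub>monoid_algebra S\<^esub>"
        by (intro bexI[of _ "- x"]) (auto simp: monoid_algebra_def in_keys_iff)
    qed (use add in \<open>auto simp: monoid_algebra_def ac_simps\<close>)
    show "comm_monoid (monoid_algebra S :: ('g \<Rightarrow>\<^sub>0 'a) ring)"
      by (rule comm_monoidI) (use mult S(1) in \<open>auto simp: monoid_algebra_def ac_simps\<close>)
  qed (simp add: monoid_algebra_def distrib_right)
qed

end

theory Submission
  imports Defs
begin

text \<open>
  Suppose \<open>\<lambda> \<in> \<Lambda>\<close> but \<open>- \<lambda> \<notin> \<Lambda>\<close>. The set \<open>{0} \<union> (\<lambda> + \<Lambda>)\<close> is a submonoid containing no pair of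
  opposite nonzero elements, so it lies in the positive cone of a total group order on \<open>\<rat>\<^sup>n\<close>.
  Reducing the coefficients modulo a minimal prime of \<open>A\<close> keeps regular elements nonzero and makes
  leading exponents with respect to this order additive. Every denominator \<open>w\<close> then has a leading
  exponent in \<open>\<Lambda>\<close>, which bounds the exponents of a sum of unit fractions by those of its
  denominator minus an element of \<open>\<Lambda>\<close>. Since \<open>\<lambda> + \<mu> > 0\<close> for all \<open>\<mu> \<in> \<Lambda>\<close>, such a sum cannot be the
  monomial with exponent \<open>\<lambda>\<close>.
\<close>

section \<open>Minimal primes\<close>

text \<open>The complement of such a set \<open>S\<close> is a minimal prime ideal.\<close>

locale max_multiplicative =
  fixes S :: "'a::comm_ring_1 set"
  assumes zero_notin: "0 \<notin> S"
    and one_in: "1 \<in> S"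
    and mult_in: "x \<in> S \<Longrightarrow> y \<in> S \<Longrightarrow> x * y \<in> S"
    and nilpotent: "x \<notin> S \<Longrightarrow> \<exists>s\<in>S. \<exists>n. s * x ^ n = 0"
begin

lemma power_in: "x \<in> S \<Longrightarrow> x ^ n \<in> S"
  by (induction n) (auto intro: one_in mult_in)

text \<open>If \<open>x\<close> were outside, then \<open>s * x ^ n = 0\<close> for some
  \<open>s\<close> in \<open>S\<close>, which makes the element \<open>s * (x * y) ^ n\<close> of
  \<open>S\<close> vanish. So the complement of \<open>S\<close> absorbs multiplication.\<close>

lemma mult_inD: "x * y \<in> S \<Longrightarrow> x \<in> S"
proof (rule ccontr)
  assume xy: "x * y \<in> S" and "x \<notin> S"
  then obtain s n where s: "s \<in> S" "s * x ^ n = 0"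
    using nilpotent by blast
  have "(x * y) ^ n \<in> S"
    using xy by (rule power_in)
  with s(1) have "s * (x * y) ^ n \<in> S"
    using mult_in by blast
  moreover have "s * (x * y) ^ n = s * x ^ n * y ^ n"
    by (simp add: power_mult_distrib mult.assoc)
  ultimately show False
    using s(2) zero_notin by simp
qed

text \<open>Together with \<open>mult_inD\<close> this makes the complement of \<open>S\<close> an
  ideal. In each binomial term of \<open>(x + y) ^ (n + m)\<close> either \<open>x\<close> has
  exponent at least \<open>n\<close> or \<open>y\<close> at least \<open>m\<close>, so
  \<open>s * t\<close> kills the whole power.\<close>

lemma add_inD: "x + y \<in> S \<Longrightarrow> x \<in> S \<or> y \<in> S"
proof (rule ccontr)
  assume xy: "x + y \<in> S" and "\<not> (x \<in> S \<or> y \<in> S)"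
  then obtain s n t m where s: "s \<in> S" "s * x ^ n = 0" and t: "t \<in> S" "t * y ^ m = 0"
    using nilpotent by meson
  have "(x + y) ^ (n + m) \<in> S"
    using xy by (rule power_in)
  then have "s * t * (x + y) ^ (n + m) \<in> S"
    using s t mult_in by blast
  moreover have "s * t * (of_nat (n + m choose k) * x ^ k * y ^ (n + m - k)) = 0" if "k \<le> n + m" for k
  proof (cases "n \<le> k")
    case True
    then have "x ^ k = x ^ n * x ^ (k - n)"
      by (simp flip: power_add)
    then have "s * t * (of_nat (n + m choose k) * x ^ k * y ^ (n + m - k)) =
      (s * x ^ n) * (t * of_nat (n + m choose k) * x ^ (k - n) * y ^ (n + m - k))"
      by (simp add: mult_ac)
    then show ?thesis
      using s(2) by simp
  next
    case False
    then have "n + m - k = m + (n - k)"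
      by simp
    then have "y ^ (n + m - k) = y ^ m * y ^ (n - k)"
      by (simp add: power_add)
    then have "s * t * (of_nat (n + m choose k) * x ^ k * y ^ (n + m - k)) =
      (t * y ^ m) * (s * of_nat (n + m choose k) * x ^ k * y ^ (n - k))"
      by (simp add: mult_ac)
    then show ?thesis
      using t(2) by simp
  qed
  then have "s * t * (x + y) ^ (n + m) = 0"
    unfolding binomial_ring sum_distrib_left by (intro sum.neutral) auto
  ultimately show False
    using zero_notin by simp
qed

lemma sum_inD:
  assumes "finite I" "sum f I \<in> S"
  shows "\<exists>i\<in>I. f i \<in> S"
  using assms by (induction I) (auto simp: zero_notin dest: add_inD)

text \<open>This is where minimality of the prime enters: finitely many of its elements have a
  common nonzero annihilator. It is reached by multiplying up one element at a time without ever
  hitting 0.\<close>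

lemma finite_annihilator:
  assumes "finite C" "C \<inter> S = {}"
  shows "\<exists>a. a \<noteq> 0 \<and> (\<forall>c\<in>C. a * c = 0)"
proof -
  \<comment> \<open>The product of the multipliers belonging to the single elements serves all of
    \<open>C\<close> at once.\<close>
  have "\<exists>s\<in>S. \<forall>c\<in>C. \<exists>n. s * c ^ n = 0"
    using assms
  proof (induction C)
    case empty
    then show ?case using one_in by auto
  next
    case (insert c C)
    then obtain s t k where s: "s \<in> S" "\<forall>c\<in>C. \<exists>n. s * c ^ n = 0" and t: "t \<in> S" "t * c ^ k = 0"
      using nilpotent[of c] by auto
    have "s * t * c ^ k = 0"
      using t(2) by (simp add: mult.assoc)
    moreover have "\<exists>n. s * t * d ^ n = 0" if "d \<in> C" for d
    proof -
      obtain n where "s * d ^ n = 0"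
        using s(2) \<open>d \<in> C\<close> by blast
      then have "t * (s * d ^ n) = 0"
        by simp
      then show ?thesis
        by (auto simp: mult_ac)
    qed
    ultimately show ?case
      using mult_in[OF s(1) t(1)] by (intro bexI[of _ "s * t"]) auto
  qed
  then obtain s where s: "s \<in> S" "\<forall>c\<in>C. \<exists>n. s * c ^ n = 0"
    by blast
  from assms(1) s(2) have "\<exists>u. s * u \<noteq> 0 \<and> (\<forall>c\<in>C. s * u * c = 0)"
  proof (induction C)
    case empty
    have "s * 1 \<noteq> 0"
      using s(1) zero_notin by auto
    then show ?case by blast
  next
    case (insert c C)
    then obtain u n where u: "s * u \<noteq> 0" "\<forall>c\<in>C. s * u * c = 0" and n: "s * c ^ n = 0"
      by auto
    have ex: "s * u * c ^ n = 0"
      using n by (metis mult.commute mult.left_commute mult_zero_right)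
    \<comment> \<open>Since \<open>s * u\<close> is nonzero, \<open>k\<close> is positive, and
      \<open>s * u * c ^ (k - 1)\<close> is nonzero but killed by \<open>c\<close>; the elements
      treated earlier still kill it.\<close>
    define k where "k = (LEAST n. s * u * c ^ n = 0)"
    have k: "s * u * c ^ k = 0"
      unfolding k_def using ex by (rule LeastI)
    with u(1) have "k \<noteq> 0"
      by (intro notI) simp
    then obtain j where j: "k = Suc j"
      by (cases k) auto
    have "s * u * c ^ j \<noteq> 0"
      using not_less_Least[of j "\<lambda>n. s * u * c ^ n = 0"] j by (auto simp: k_def)
    moreover have "s * u * c ^ j * c = 0"
      using k j by (simp add: mult_ac)
    moreover have "s * u * c ^ j * d = 0" if "d \<in> C" for d
    proof -
      have "s * u * d * c ^ j = 0"
        using u(2) that by simp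
      then show ?thesis
        by (simp add: mult_ac)
    qed
    ultimately show ?case
      by (intro exI[of _ "u * c ^ j"]) (auto simp: mult.assoc)
  qed
  then show ?thesis
    by blast
qed

end

text \<open>Zorn's lemma gives a maximal multiplicative set avoiding 0. Adjoining an outside element
  \<open>x\<close> must then produce 0, which is exactly the relation
  \<open>s * x ^ n = 0\<close>.\<close>

lemma max_multiplicative_exists: "\<exists>S :: 'a::comm_ring_1 set. max_multiplicative S"
proof -
  define A where "A = {S :: 'a set. 0 \<notin> S \<and> 1 \<in> S \<and> (\<forall>x\<in>S. \<forall>y\<in>S. x * y \<in> S)}"
  have "\<exists>S\<in>A. \<forall>X\<in>A. S \<subseteq> X \<longrightarrow> X = S"
  proof (rule subset_Zorn_nonempty)
    \<comment> \<open>This relies on 0 \<noteq> 1 in \<open>comm_ring_1\<close>, that is, on nonzero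
      coefficient rings.\<close>
    have "{1} \<in> A"
      by (auto simp: A_def)
    then show "A \<noteq> {}"
      by blast
  next
    fix \<C> assume ne: "\<C> \<noteq> {}" and "subset.chain A \<C>"
    then have sub: "\<C> \<subseteq> A" and lin: "\<And>X Y. X \<in> \<C> \<Longrightarrow> Y \<in> \<C> \<Longrightarrow> X \<subseteq> Y \<or> Y \<subseteq> X"
      by (auto simp: subset.chain_def)
    have "x * y \<in> \<Union>\<C>" if xy: "x \<in> X" "X \<in> \<C>" "y \<in> Y" "Y \<in> \<C>" for x y X Y
    proof -
      obtain Z where "Z \<in> \<C>" "x \<in> Z" "y \<in> Z"
        using lin[OF xy(2,4)] xy by blast
      then show ?thesis
        using sub by (auto simp: A_def)
    qed
    then show "\<Union>\<C> \<in> A"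
      using sub ne by (auto simp: A_def)
  qed
  then obtain S where S: "S \<in> A" and max: "\<And>X. X \<in> A \<Longrightarrow> S \<subseteq> X \<Longrightarrow> X = S"
    by blast
  have "max_multiplicative S"
  proof
    show "0 \<notin> S" "1 \<in> S" "\<And>x y. x \<in> S \<Longrightarrow> y \<in> S \<Longrightarrow> x * y \<in> S"
      using S by (auto simp: A_def)
    fix x assume x: "x \<notin> S"
    show "\<exists>s\<in>S. \<exists>n. s * x ^ n = 0"
    proof (rule ccontr)
      assume contra: "\<not> ?thesis"
      \<comment> \<open>The multiplicative set generated by \<open>S\<close> and \<open>x\<close>;
        \<open>contra\<close> says that it avoids 0.\<close>
      define T where "T = {s * x ^ n |s n. s \<in> S}"
      have "a * b \<in> T" if ab: "a \<in> T" "b \<in> T" for a b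
      proof -
        from ab obtain s n t m where st: "a = s * x ^ n" "b = t * x ^ m" "s \<in> S" "t \<in> S"
          by (auto simp: T_def)
        then have "a * b = (s * t) * x ^ (n + m)"
          by (simp add: power_add mult_ac)
        moreover have "s * t \<in> S"
          using st S by (auto simp: A_def)
        ultimately show ?thesis
          by (auto simp: T_def)
      qed
      moreover have "0 \<notin> T"
      proof
        assume "0 \<in> T"
        then obtain s n where "s \<in> S" "0 = s * x ^ n"
          by (auto simp: T_def)
        with contra show False
          by metis
      qed
      moreover have ST: "S \<subseteq> T"
      proof
        fix s assume "s \<in> S"
        then show "s \<in> T"
          unfolding T_def by (intro CollectI exI[of _ s] exI[of _ 0]) simp
      qed
      moreover have "1 \<in> S"
        using S by (simp add: A_def)
      ultimately have "T \<in> A"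
        by (auto simp: A_def)
      with ST max have "T = S"
        by blast
      moreover have "x \<in> T"
        unfolding T_def using \<open>1 \<in> S\<close> by (intro CollectI exI[of _ 1] exI[of _ "1::nat"]) simp
      ultimately show False
        using x by simp
    qed
  qed
  then show ?thesis
    by blast
qed

section \<open>Positive cones of total group orders\<close>

text \<open>The order is encoded by its nonnegative elements: \<open>g\<close> is at most
  \<open>d\<close> when \<open>d - g \<in> P\<close>.\<close>

locale total_cone =
  fixes P :: "'g::ab_group_add set"
  assumes zero_in: "0 \<in> P"
    and add_in: "x \<in> P \<Longrightarrow> y \<in> P \<Longrightarrow> x + y \<in> P"
    and pointed: "x \<in> P \<Longrightarrow> - x \<in> P \<Longrightarrow> x = 0"
    and total: "x \<in> P \<or> - x \<in> P"
begin

lemma finite_max: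
  assumes "finite X" "X \<noteq> {}"
  shows "\<exists>d\<in>X. \<forall>g\<in>X. d - g \<in> P"
  using assms
proof (induction X rule: finite_ne_induct)
  case (singleton x)
  then show ?case by (simp add: zero_in)
next
  case (insert x X)
  then obtain d where d: "d \<in> X" "\<forall>g\<in>X. d - g \<in> P"
    by blast
  show ?case
  proof (cases "d - x \<in> P")
    case True
    with d show ?thesis by auto
  next
    case False
    then have "x - d \<in> P"
      using total[of "d - x"] by simp
    then have "x - g \<in> P" if "g \<in> X" for g
      using add_in[of "x - d" "d - g"] d(2) that by simp
    then show ?thesis
      by (auto simp: zero_in)
  qed
qed

end

text \<open>A maximal pointed submonoid above \<open>N\<close> is total: if \<open>x\<close> is
  outside, some positive multiple of \<open>- x\<close> is inside. If \<open>- x\<close> were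
  outside too, a common multiple of \<open>x\<close> and its negative would both lie inside, against
  torsion-freeness.\<close>

lemma total_cone_exists:
  fixes N :: "(rat ^ 'n) set"
  assumes N0: "0 \<in> N" and N_add: "\<And>x y. x \<in> N \<Longrightarrow> y \<in> N \<Longrightarrow> x + y \<in> N"
    and N_pointed: "\<And>x. x \<in> N \<Longrightarrow> - x \<in> N \<Longrightarrow> x = 0"
  shows "\<exists>P. N \<subseteq> P \<and> total_cone P"
proof -
  define A where "A = {P. N \<subseteq> P \<and> (\<forall>x\<in>P. \<forall>y\<in>P. x + y \<in> P) \<and> (\<forall>x\<in>P. - x \<in> P \<longrightarrow> x = 0)}"
  have "\<exists>P\<in>A. \<forall>X\<in>A. P \<subseteq> X \<longrightarrow> X = P"
  proof (rule subset_Zorn_nonempty)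
    have "N \<in> A"
      using assms by (auto simp: A_def)
    then show "A \<noteq> {}"
      by blast
  next
    fix \<C> assume ne: "\<C> \<noteq> {}" and "subset.chain A \<C>"
    then have sub: "\<C> \<subseteq> A" and lin: "\<And>X Y. X \<in> \<C> \<Longrightarrow> Y \<in> \<C> \<Longrightarrow> X \<subseteq> Y \<or> Y \<subseteq> X"
      by (auto simp: subset.chain_def)
    have common: "\<exists>Z\<in>\<C>. x \<in> Z \<and> y \<in> Z" if "x \<in> \<Union>\<C>" "y \<in> \<Union>\<C>" for x y
      using that lin by blast
    have "x + y \<in> \<Union>\<C>" if "x \<in> \<Union>\<C>" "y \<in> \<Union>\<C>" for x y
      using common[OF that] sub by (auto simp: A_def)
    moreover have "x = 0" if "x \<in> \<Union>\<C>" "- x \<in> \<Union>\<C>" for x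
      using common[OF that] sub by (auto simp: A_def)
    moreover have "N \<subseteq> \<Union>\<C>"
      using ne sub by (fastforce simp: A_def)
    ultimately show "\<Union>\<C> \<in> A"
      unfolding A_def by blast
  qed
  then obtain P where P: "P \<in> A" and max: "\<And>X. X \<in> A \<Longrightarrow> P \<subseteq> X \<Longrightarrow> X = P"
    by blast
  have NP: "N \<subseteq> P" and add: "\<And>x y. x \<in> P \<Longrightarrow> y \<in> P \<Longrightarrow> x + y \<in> P"
    and ptd: "\<And>x. x \<in> P \<Longrightarrow> - x \<in> P \<Longrightarrow> x = 0"
    using P by (auto simp: A_def)
  have zero: "0 \<in> P"
    using N0 NP by blast
  have scale: "of_nat k *s x \<in> P" if "x \<in> P" for k :: nat and x
    by (induction k) (use that zero add in \<open>auto simp: vector_sadd_rdistrib\<close>)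
  have opposite: "\<exists>k>0. - (of_nat k *s x) \<in> P" if x: "x \<notin> P" for x
  proof -
    \<comment> \<open>The submonoid generated by \<open>P\<close> and \<open>x\<close>. By
      maximality it is not pointed, and adding an opposite pair \<open>a\<close>, \<open>- a\<close>
      in it leaves \<open>(p + q) + (k + l) x = 0\<close>.\<close>
    define Q where "Q = {p + of_nat k *s x |p (k::nat). p \<in> P}"
    have PQ: "P \<subseteq> Q"
    proof
      fix p assume "p \<in> P"
      then show "p \<in> Q"
        unfolding Q_def by (intro CollectI exI[of _ p] exI[of _ 0]) simp
    qed
    have "x \<in> Q"
      unfolding Q_def using zero by (intro CollectI exI[of _ 0] exI[of _ "1::nat"]) simp
    with x PQ max have "Q \<notin> A"
      by blast
    moreover have "a + b \<in> Q" if ab: "a \<in> Q" "b \<in> Q" for a b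
    proof -
      from ab obtain p k q l where pq: "a = p + of_nat k *s x" "b = q + of_nat l *s x" "p \<in> P" "q \<in> P"
        by (auto simp: Q_def)
      then have "a + b = (p + q) + of_nat (k + l) *s x"
        by (simp add: vector_sadd_rdistrib)
      with add[OF pq(3,4)] show ?thesis
        unfolding Q_def by blast
    qed
    ultimately obtain a where a: "a \<in> Q" "- a \<in> Q" "a \<noteq> 0"
      using NP PQ unfolding A_def by blast
    then obtain p k q l where pq: "a = p + of_nat k *s x" "- a = q + of_nat l *s x" "p \<in> P" "q \<in> P"
      by (auto simp: Q_def)
    have eq: "- (of_nat (k + l) *s x) = p + q"
    proof -
      have "(p + q) + of_nat (k + l) *s x = a + - a"
        unfolding pq(2) by (subst pq(1)) (simp add: vector_sadd_rdistrib)
      then have "of_nat (k + l) *s x + (p + q) = 0"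
        by (simp add: add.commute)
      then show ?thesis
        by (rule minus_unique)
    qed
    \<comment> \<open>Otherwise \<open>a\<close> and \<open>- a\<close> would already be an opposite
      pair in \<open>P\<close>.\<close>
    have "k + l > 0"
    proof (rule ccontr)
      assume "\<not> k + l > 0"
      then have "k = 0" "l = 0"
        by simp_all
      then have "a = p" "q = - a"
        using pq(1,2) by (simp, metis add.right_neutral of_nat_0 vector_smult_lzero)
      with pq(3,4) a(3) ptd show False
        by blast
    qed
    moreover have "- (of_nat (k + l) *s x) \<in> P"
      unfolding eq using pq(3,4) by (rule add)
    ultimately show ?thesis
      by blast
  qed
  have "total_cone P"
  proof
    fix x
    show "x \<in> P \<or> - x \<in> P"
    proof (rule ccontr)
      assume contra: "\<not> ?thesis"
      then obtain k l where kl: "k > 0" "l > 0" "- (of_nat k *s x) \<in> P" "- (of_nat l *s - x) \<in> P"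
        using opposite[of x] opposite[of "- x"] by blast
      \<comment> \<open>Scaling crosswise turns the two memberships into one about
        \<open>k * l\<close> times \<open>x\<close> and one about its negative.\<close>
      have "of_nat l *s - (of_nat k *s x) \<in> P" "of_nat k *s - (of_nat l *s - x) \<in> P"
        using scale kl(3,4) by blast+
      then have "- (of_nat (k * l) *s x) \<in> P" "of_nat (k * l) *s x \<in> P"
        by (simp_all add: vector_smult_assoc mult_ac vector_smult_rneg)
      then have "of_nat (k * l) *s x = 0"
        using ptd by blast
      with kl(1,2) have "x = 0"
        by (simp add: vector_mul_eq_0)
      with contra zero show False
        by simp
    qed
  qed (use zero add ptd in auto)
  with NP show ?thesis
    by blast
qed

section \<open>Leading exponents\<close>

text \<open>In a group the equation \<open>k = l + q\<close> has the single solution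
  \<open>q = k - l\<close>, so the double sum of the convolution collapses.\<close>

lemma lookup_mult_group:
  fixes f g :: "'g::ab_group_add \<Rightarrow>\<^sub>0 'a::comm_ring_1"
  shows "Poly_Mapping.lookup (f * g) k =
    (\<Sum>a\<in>Poly_Mapping.keys f. Poly_Mapping.lookup f a * Poly_Mapping.lookup g (k - a))"
proof -
  have "(\<Sum>q. Poly_Mapping.lookup g q when k = l + q) = Poly_Mapping.lookup g (k - l)" for l
  proof -
    have "(\<lambda>q. Poly_Mapping.lookup g q when k = l + q) = (\<lambda>q. Poly_Mapping.lookup g q when q = k - l)"
      by (auto simp: fun_eq_iff when_def algebra_simps)
    then show ?thesis
      by (simp only: Sum_any_when_equal)
  qed
  then have "Poly_Mapping.lookup (f * g) k =
      (\<Sum>a. Poly_Mapping.lookup f a * Poly_Mapping.lookup g (k - a))"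
    by (simp add: lookup_mult)
  also have "\<dots> = (\<Sum>a\<in>Poly_Mapping.keys f. Poly_Mapping.lookup f a * Poly_Mapping.lookup g (k - a))"
    by (rule Sum_any.expand_superset) (auto simp: in_keys_iff)
  finally show ?thesis .
qed

locale leading_exponents = max_multiplicative S + total_cone P
  for S :: "'a::comm_ring_1 set" and P :: "'g::ab_group_add set"
begin

text \<open>The support of \<open>f\<close> after reducing coefficients modulo the minimal prime,
  expressed without forming the quotient ring.\<close>

definition supp :: "('g \<Rightarrow>\<^sub>0 'a) \<Rightarrow> 'g set" where
  "supp f = {g. Poly_Mapping.lookup f g \<in> S}"

text \<open>A relation and not a function, because \<open>supp f\<close> may be empty.\<close>

definition leading :: "('g \<Rightarrow>\<^sub>0 'a) \<Rightarrow> 'g \<Rightarrow> bool" where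
  "leading f d \<longleftrightarrow> d \<in> supp f \<and> (\<forall>g\<in>supp f. d - g \<in> P)"

lemma supp_subset_keys: "supp f \<subseteq> Poly_Mapping.keys f"
  using zero_notin by (auto simp: supp_def in_keys_iff)

lemma supp_zero [simp]: "supp 0 = {}"
  by (simp add: supp_def zero_notin)

lemma supp_add: "supp (f + g) \<subseteq> supp f \<union> supp g"
  by (auto simp: supp_def lookup_add dest: add_inD)

text \<open>A coefficient of the product that survives modulo the prime has a surviving summand, and
  both factors of that summand survive.\<close>

lemma supp_mult:
  assumes "x \<in> supp (f * g)"
  obtains a b where "a \<in> supp f" "b \<in> supp g" "x = a + b"
proof -
  from assms have "(\<Sum>a\<in>Poly_Mapping.keys f. Poly_Mapping.lookup f a * Poly_Mapping.lookup g (x - a)) \<in> S"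
    by (simp add: supp_def lookup_mult_group)
  then obtain a where a: "Poly_Mapping.lookup f a * Poly_Mapping.lookup g (x - a) \<in> S"
    using sum_inD[OF finite_keys] by blast
  have "a \<in> supp f" "x - a \<in> supp g"
    using mult_inD[OF a] mult_inD[OF a[unfolded mult.commute[of "Poly_Mapping.lookup f a"]]]
    by (simp_all add: supp_def)
  then show thesis
    by (intro that[of a "x - a"]) auto
qed

text \<open>The product of the leading coefficients stays in \<open>S\<close>. Every other
  contribution at \<open>d + e\<close> lies in the prime, since it would otherwise need an exponent
  exceeding \<open>d\<close> or \<open>e\<close>.\<close>

lemma leading_mult:
  assumes "leading f d" "leading g e"
  shows "leading (f * g) (d + e)"
proof -
  have "d + e - x \<in> P" if x: "x \<in> supp (f * g)" for x
  proof -
    obtain a b where "a \<in> supp f" "b \<in> supp g" "x = a + b"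
      using x by (rule supp_mult)
    then show ?thesis
      using assms add_in[of "d - a" "e - b"] by (auto simp: leading_def algebra_simps)
  qed
  moreover have "d + e \<in> supp (f * g)"
  proof (rule ccontr)
    let ?t = "\<lambda>a. Poly_Mapping.lookup f a * Poly_Mapping.lookup g (d + e - a)"
    assume notin: "d + e \<notin> supp (f * g)"
    have d: "d \<in> Poly_Mapping.keys f"
      using assms(1) supp_subset_keys by (auto simp: leading_def)
    have "Poly_Mapping.lookup (f * g) (d + e) = ?t d + (\<Sum>a\<in>Poly_Mapping.keys f - {d}. ?t a)"
      unfolding lookup_mult_group by (rule sum.remove) (use d in auto)
    \<comment> \<open>The difference is written as a sum with factor \<open>- 1\<close>, to which
      \<open>add_inD\<close> and \<open>mult_inD\<close> apply.\<close>
    then have "?t d = Poly_Mapping.lookup (f * g) (d + e) + - 1 * (\<Sum>a\<in>Poly_Mapping.keys f - {d}. ?t a)"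
      by simp
    moreover have "?t d \<in> S"
      using assms mult_in by (simp add: leading_def supp_def)
    ultimately have "- 1 * (\<Sum>a\<in>Poly_Mapping.keys f - {d}. ?t a) \<in> S"
      using add_inD notin by (metis (no_types, lifting) mem_Collect_eq supp_def)
    then have "(\<Sum>a\<in>Poly_Mapping.keys f - {d}. ?t a) \<in> S"
      by (metis mult.commute mult_inD)
    then obtain a where a: "a \<noteq> d" "?t a \<in> S"
      using sum_inD[OF finite_Diff[OF finite_keys]] by blast
    have "a \<in> supp f" "d + e - a \<in> supp g"
      using mult_inD[OF a(2)] mult_inD[OF a(2)[unfolded mult.commute[of "Poly_Mapping.lookup f a"]]]
      by (simp_all add: supp_def)
    \<comment> \<open>The second element equals \<open>a - d\<close>, the opposite of the
      first.\<close>
    then have "d - a \<in> P" "e - (d + e - a) \<in> P"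
      using assms by (auto simp: leading_def)
    then have "d - a = 0"
      using pointed[of "d - a"] by simp
    with a show False
      by simp
  qed
  ultimately show ?thesis
    by (simp add: leading_def)
qed

lemma leading_exists:
  assumes "supp f \<noteq> {}"
  shows "\<exists>d. leading f d"
proof -
  have "finite (supp f)"
    by (rule finite_subset[OF supp_subset_keys]) simp
  from finite_max[OF this assms] show ?thesis
    by (auto simp: leading_def)
qed

text \<open>If all coefficients of \<open>w\<close> lay in the prime,
  \<open>finite_annihilator\<close> would give a nonzero constant killing \<open>w\<close>.\<close>

lemma supp_nonempty_if_cancellable:
  assumes "\<And>a. Poly_Mapping.single 0 a * w = 0 \<Longrightarrow> a = 0"
  shows "supp w \<noteq> {}"
proof
  assume "supp w = {}"
  then have "Poly_Mapping.lookup w ` Poly_Mapping.keys w \<inter> S = {}"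
    by (auto simp: supp_def)
  then obtain a where a: "a \<noteq> 0" "\<And>g. g \<in> Poly_Mapping.keys w \<Longrightarrow> a * Poly_Mapping.lookup w g = 0"
    using finite_annihilator[of "Poly_Mapping.lookup w ` Poly_Mapping.keys w"] by auto
  have "a * Poly_Mapping.lookup w g = 0" for g
    using a(2)[of g] by (cases "g \<in> Poly_Mapping.keys w") (auto simp: in_keys_iff)
  then have "Poly_Mapping.single 0 a * w = 0"
    by (intro poly_mapping_eqI) (simp add: lookup_mult_group)
  with assms a(1) show False
    by blast
qed

end

section \<open>Sums of unit fractions\<close>

text \<open>Removes the multiplier \<open>t\<close> from an equality of fractions, so that it
  becomes an identity in the algebra itself.\<close>

lemma regular_monoid_algebra_cancel:
  fixes t x y :: "'g::ab_group_add \<Rightarrow>\<^sub>0 'a::comm_ring_1"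
  assumes "t \<in> regular_elements (monoid_algebra \<Lambda>)"
    and "Poly_Mapping.keys x \<subseteq> \<Lambda>" "Poly_Mapping.keys y \<subseteq> \<Lambda>" "t * x = t * y"
  shows "x = y"
proof -
  have "Poly_Mapping.keys (x - y) \<subseteq> \<Lambda>"
    using keys_diff[of x y] assms(2,3) by blast
  moreover have "t * (x - y) = 0"
    using assms(4) by (simp add: right_diff_distrib)
  ultimately have "x - y = 0"
    using assms(1) unfolding regular_elements_def monoid_algebra_def by auto
  then show ?thesis
    by simp
qed

context leading_exponents
begin

text \<open>Constants belong to the algebra because 0 is in \<open>\<Lambda>\<close>, so regularity
  forbids a nonzero constant from killing \<open>w\<close>.\<close>

lemma regular_leading:
  assumes "w \<in> regular_elements (monoid_algebra \<Lambda>)" "0 \<in> \<Lambda>"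
  obtains d where "leading w d" "d \<in> \<Lambda>"
proof -
  have "a = 0" if "Poly_Mapping.single 0 a * w = 0" for a
  proof -
    have "w * Poly_Mapping.single 0 a = 0"
      using that by (simp add: mult.commute)
    then have "Poly_Mapping.single 0 a = (0 :: 'g \<Rightarrow>\<^sub>0 'a)"
      using assms by (simp add: regular_elements_def monoid_algebra_def split: if_splits)
    then show ?thesis
      by (metis lookup_single_eq lookup_zero)
  qed
  then obtain d where d: "leading w d"
    using leading_exists supp_nonempty_if_cancellable by blast
  moreover have "d \<in> \<Lambda>"
    using d supp_subset_keys[of w] assms(1)
    by (auto simp: leading_def regular_elements_def monoid_algebra_def)
  ultimately show thesis
    by (rule that)
qed

text \<open>Induction along \<open>1 / w + r / s = (s + r * w) / (w * s)\<close>. The new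
  denominator has leading exponent \<open>e + d\<close>, and every exponent of the numerator falls
  short of it by at least some element of \<open>\<Lambda>\<close>.\<close>

lemma unit_fraction_sum:
  fixes \<Lambda> :: "'g set" and w :: "nat \<Rightarrow> ('g \<Rightarrow>\<^sub>0 'a)"
  defines "R \<equiv> monoid_algebra \<Lambda> :: ('g \<Rightarrow>\<^sub>0 'a) ring"
  defines "W \<equiv> regular_elements R"
  assumes sub: "submonoid \<Lambda> (additive_monoid UNIV)"
    and w: "\<And>i. i < m \<Longrightarrow> w i \<in> W"
  shows "\<exists>r\<in>carrier R. \<exists>s\<in>W. \<exists>d. leading s d \<and> d \<in> \<Lambda> \<and>
    (\<Oplus>\<^bsub>localization R W\<^esub> i\<in>{..<m}. loc_frac R W \<one>\<^bsub>R\<^esub> (w i)) = loc_frac R W r s \<and>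
    (\<forall>g\<in>supp r. \<exists>\<mu>\<in>\<Lambda>. d - \<mu> - g \<in> P)"
  using w
proof (induction m)
  case 0
  interpret R: cring R
    unfolding R_def by (rule cring_monoid_algebra[OF sub])
  interpret ring_localization R W
    unfolding W_def by (rule R.ring_localization_regular)
  interpret L: cring "localization R W"
    by (rule cring_localization)
  have \<Lambda>: "0 \<in> \<Lambda>"
    using submonoid.one_closed[OF sub] by (simp add: additive_monoid_def)
  \<comment> \<open>The empty sum is 0/1; its numerator has empty \<open>supp\<close>, so the bound
    is vacuous.\<close>
  obtain d where "leading (\<one>\<^bsub>R\<^esub>) d" "d \<in> \<Lambda>"
    using regular_leading[of "\<one>\<^bsub>R\<^esub>" \<Lambda>] one_closed \<Lambda> by (auto simp: W_def R_def)
  then show ?case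
    using R.zero_closed
    by (intro bexI[of _ "\<zero>\<^bsub>R\<^esub>"] bexI[of _ "\<one>\<^bsub>R\<^esub>"] exI[of _ d])
      (auto simp: zero_localization monoid_algebra_def R_def[symmetric],
        simp add: R_def monoid_algebra_def)
next
  case (Suc m)
  interpret R: cring R
    unfolding R_def by (rule cring_monoid_algebra[OF sub])
  interpret ring_localization R W
    unfolding W_def by (rule R.ring_localization_regular)
  interpret L: cring "localization R W"
    by (rule cring_localization)
  have \<Lambda>: "0 \<in> \<Lambda>" "\<And>x y. x \<in> \<Lambda> \<Longrightarrow> y \<in> \<Lambda> \<Longrightarrow> x + y \<in> \<Lambda>"
    using submonoid.one_closed[OF sub] submonoid.m_closed[OF sub]
    by (auto simp: additive_monoid_def)
  have R_simps: "x \<otimes>\<^bsub>R\<^esub> y = x * y" "x \<oplus>\<^bsub>R\<^esub> y = x + y" "\<one>\<^bsub>R\<^esub> = 1" for x y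
    by (simp_all add: R_def monoid_algebra_def)
  obtain r s d where r: "r \<in> carrier R" and s: "s \<in> W" and d: "leading s d" "d \<in> \<Lambda>"
    and sum: "(\<Oplus>\<^bsub>localization R W\<^esub> i\<in>{..<m}. loc_frac R W \<one>\<^bsub>R\<^esub> (w i)) = loc_frac R W r s"
    and bound: "\<And>g. g \<in> supp r \<Longrightarrow> \<exists>\<mu>\<in>\<Lambda>. d - \<mu> - g \<in> P"
    using Suc by auto
  have wm: "w m \<in> W"
    using Suc.prems by simp
  then obtain e where e: "leading (w m) e" "e \<in> \<Lambda>"
    using regular_leading[of "w m" \<Lambda>] \<Lambda> by (auto simp: W_def R_def)
  have "(\<Oplus>\<^bsub>localization R W\<^esub> i\<in>{..<Suc m}. loc_frac R W \<one>\<^bsub>R\<^esub> (w i)) =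
      loc_frac R W \<one>\<^bsub>R\<^esub> (w m) \<oplus>\<^bsub>localization R W\<^esub> loc_frac R W r s"
    unfolding lessThan_Suc
    by (subst L.finsum_insert) (use Suc.prems in \<open>auto simp: sum\<close>)
  also have "\<dots> = loc_frac R W (s + r * w m) (w m * s)"
    using loc_frac_add[of "\<one>\<^bsub>R\<^esub>" "w m" r s] r s wm W_carrier[OF s] R.one_closed
    by (simp add: R_simps)
  finally have "(\<Oplus>\<^bsub>localization R W\<^esub> i\<in>{..<Suc m}. loc_frac R W \<one>\<^bsub>R\<^esub> (w i)) =
      loc_frac R W (s + r * w m) (w m * s)" .
  moreover have "s + r * w m \<in> carrier R"
    using R.a_closed[OF W_carrier[OF s] R.m_closed[OF r W_carrier[OF wm]]] by (simp add: R_simps)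
  moreover have "w m * s \<in> W"
    using m_closed[OF wm s] by (simp add: R_simps)
  moreover have "leading (w m * s) (e + d)" "e + d \<in> \<Lambda>"
    using leading_mult d e \<Lambda> by auto
  moreover have "\<exists>\<mu>\<in>\<Lambda>. e + d - \<mu> - g \<in> P" if "g \<in> supp (s + r * w m)" for g
  proof -
    from that consider "g \<in> supp s" | "g \<in> supp (r * w m)"
      using supp_add by blast
    then show ?thesis
    proof cases
      case 1
      then have "d - g \<in> P"
        using d by (simp add: leading_def)
      \<comment> \<open>Exponents of \<open>s\<close> are at most \<open>d = (e + d) - e\<close>, so
        the gap is the leading exponent \<open>e\<close> of the new denominator.\<close>
      with e(2) show ?thesis
        by (intro bexI[of _ e]) auto
    next
      case 2
      then obtain a b where ab: "a \<in> supp r" "b \<in> supp (w m)" "g = a + b"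
        by (rule supp_mult)
      then obtain \<mu> where "\<mu> \<in> \<Lambda>" "d - \<mu> - a \<in> P"
        using bound by blast
      \<comment> \<open>Multiplying by \<open>w m\<close> raises exponents by at most
        \<open>e\<close>, so the gap \<mu> of \<open>r\<close> is kept.\<close>
      moreover have "e - b \<in> P"
        using e ab by (simp add: leading_def)
      ultimately show ?thesis
        using add_in[of "d - \<mu> - a" "e - b"] ab(3)
        by (intro bexI[of _ \<mu>]) (auto simp: algebra_simps)
    qed
  qed
  ultimately show ?case
    by blast
qed

text \<open>The monomial at \<open>l\<close> is the witness. Were it \<open>r / s\<close>, then
  \<open>r\<close> would have exponent \<open>l + d\<close>, but the bound asks for at most
  \<open>d - \<mu>\<close>; hence \<open>l + \<mu>\<close> is both nonnegative and nonpositive, and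
  \<open>- l = \<mu>\<close> lies in \<open>\<Lambda>\<close>.\<close>

lemma monomial_not_unit_fraction_sum:
  fixes \<Lambda> :: "'g set"
  assumes sub: "submonoid \<Lambda> (additive_monoid UNIV)"
    and l: "l \<in> \<Lambda>" "- l \<notin> \<Lambda>"
    and pos: "\<And>\<mu>. \<mu> \<in> \<Lambda> \<Longrightarrow> l + \<mu> \<in> P"
  shows "\<not> Egyptian_ring (monoid_algebra \<Lambda> :: ('g \<Rightarrow>\<^sub>0 'a) ring)"
proof
  define R where "R = (monoid_algebra \<Lambda> :: ('g \<Rightarrow>\<^sub>0 'a) ring)"
  define W where "W = regular_elements R"
  define X where "X = (Poly_Mapping.single l 1 :: 'g \<Rightarrow>\<^sub>0 'a)"
  interpret R: cring R
    unfolding R_def by (rule cring_monoid_algebra[OF sub])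
  interpret ring_localization R W
    unfolding W_def by (rule R.ring_localization_regular)
  have R_simps: "x \<otimes>\<^bsub>R\<^esub> y = x * y" "\<one>\<^bsub>R\<^esub> = 1" "carrier R = {f. Poly_Mapping.keys f \<subseteq> \<Lambda>}" for x y
    by (simp_all add: R_def monoid_algebra_def)
  have X: "X \<in> carrier R" "X \<noteq> \<zero>\<^bsub>R\<^esub>"
    using l by (simp_all add: R_def monoid_algebra_def X_def flip: keys_eq_empty)
  assume "Egyptian_ring (monoid_algebra \<Lambda> :: ('g \<Rightarrow>\<^sub>0 'a) ring)"
  then obtain m :: nat and w where w: "\<And>i. i < m \<Longrightarrow> w i \<in> W" and
    eq: "loc_frac R W X \<one>\<^bsub>R\<^esub> = (\<Oplus>\<^bsub>localization R W\<^esub> i\<in>{..<m}. loc_frac R W \<one>\<^bsub>R\<^esub> (w i))"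
    using X unfolding Egyptian_ring_def Let_def R_def[symmetric] W_def[symmetric] by blast
  obtain r s d where r: "r \<in> carrier R" and s: "s \<in> W" and d: "leading s d"
    and frac: "loc_frac R W X \<one>\<^bsub>R\<^esub> = loc_frac R W r s"
    and bound: "\<And>g. g \<in> supp r \<Longrightarrow> \<exists>\<mu>\<in>\<Lambda>. d - \<mu> - g \<in> P"
    using unit_fraction_sum[OF sub, folded R_def, folded W_def, of m w] w eq by auto
  obtain t where "t \<in> W" "t * (X * s) = t * r"
    using frac loc_frac_eq_iff[OF X(1) one_closed r s] by (auto simp: R_simps)
  moreover have "X * s \<in> carrier R"
    using R.m_closed[OF X(1) W_carrier[OF s]] by (simp add: R_simps(1))
  ultimately have Xs: "X * s = r"
    using regular_monoid_algebra_cancel[of t \<Lambda> "X * s" r] r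
    by (simp add: R_simps(3) W_def flip: R_def)
  have "supp X = {l}"
    using one_in zero_notin by (auto simp: supp_def X_def lookup_single when_def split: if_splits)
  then have "leading X l"
    by (simp add: leading_def zero_in)
  from leading_mult[OF this d] have "l + d \<in> supp r"
    by (simp add: Xs leading_def)
  then obtain \<mu> where \<mu>: "\<mu> \<in> \<Lambda>" "d - \<mu> - (l + d) \<in> P"
    using bound by blast
  have "d - \<mu> - (l + d) = - (l + \<mu>)"
    by (simp add: algebra_simps)
  then have "l + \<mu> = 0"
    using pointed[OF pos[OF \<mu>(1)]] \<mu>(2) by argo
  then have "- l = \<mu>"
    by (rule minus_unique)
  with \<mu>(1) l(2) show False
    by simp
qed

end

theorem theorem2p16:
  fixes \<Lambda> :: "(rat ^ 'n) set"
    and R :: "((rat ^ 'n) \<Rightarrow>\<^sub>0 'a::comm_ring_1) ring"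
  assumes "submonoid \<Lambda> (additive_monoid UNIV)"
    and "R = monoid_algebra \<Lambda>"
    and "\<not> group (additive_monoid \<Lambda>)"
  shows "\<not> Egyptian_ring R"
proof -
  have \<Lambda>: "0 \<in> \<Lambda>" "\<And>x y. x \<in> \<Lambda> \<Longrightarrow> y \<in> \<Lambda> \<Longrightarrow> x + y \<in> \<Lambda>"
    using submonoid.one_closed[OF assms(1)] submonoid.m_closed[OF assms(1)]
    by (auto simp: additive_monoid_def)
  have "\<exists>l\<in>\<Lambda>. - l \<notin> \<Lambda>"
  proof (rule ccontr)
    assume contra: "\<not> ?thesis"
    have "group (additive_monoid \<Lambda>)"
    proof (rule groupI)
      fix x assume "x \<in> carrier (additive_monoid \<Lambda>)"
      then show "\<exists>y\<in>carrier (additive_monoid \<Lambda>).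
          y \<otimes>\<^bsub>additive_monoid \<Lambda>\<^esub> x = \<one>\<^bsub>additive_monoid \<Lambda>\<^esub>"
        using contra by (intro bexI[of _ "- x"]) (auto simp: additive_monoid_def)
    qed (use \<Lambda> in \<open>auto simp: additive_monoid_def add.assoc\<close>)
    with assms(3) show False ..
  qed
  then obtain l where l: "l \<in> \<Lambda>" "- l \<notin> \<Lambda>"
    by blast
  \<comment> \<open>\<open>\<Lambda>\<close> itself may contain opposite pairs, so only its
    translate by \<open>l\<close> is made nonnegative; a cone containing \<open>N\<close> meets the
    positivity hypothesis of \<open>monomial_not_unit_fraction_sum\<close>.\<close>
  define N where "N = insert 0 ((+) l ` \<Lambda>)"
  have N_add: "x + y \<in> N" if xy: "x \<in> N" "y \<in> N" for x y
  proof (cases "x = 0 \<or> y = 0")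
    case True
    with xy show ?thesis by auto
  next
    case False
    with xy obtain a b where "x = l + a" "y = l + b" "a \<in> \<Lambda>" "b \<in> \<Lambda>"
      by (auto simp: N_def)
    moreover from this have "x + y = l + (a + (l + b))"
      by simp
    ultimately show ?thesis
      using \<Lambda> l(1) unfolding N_def by blast
  qed
  have N_pointed: "x = 0" if xy: "x \<in> N" "- x \<in> N" for x
  proof (rule ccontr)
    assume "x \<noteq> 0"
    with xy obtain a b where ab: "x = l + a" "- x = l + b" "a \<in> \<Lambda>" "b \<in> \<Lambda>"
      by (auto simp: N_def)
    \<comment> \<open>An opposite pair in the translate would exhibit \<open>- l\<close> as
      \<open>a + (l + b)\<close>, an element of \<open>\<Lambda>\<close>.\<close>
    have "l + (a + (l + b)) = x + - x"
      unfolding ab(2) by (simp add: ab(1) add.assoc)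
    then have "- l = a + (l + b)"
      by (intro minus_unique) simp
    with l ab \<Lambda> show False
      by metis
  qed
  have "0 \<in> N"
    by (simp add: N_def)
  then obtain P where P: "N \<subseteq> P" "total_cone P"
    using total_cone_exists[of N] N_add N_pointed by blast
  obtain S :: "'a set" where S: "max_multiplicative S"
    using max_multiplicative_exists by blast
  interpret leading_exponents S P
    using S P(2) by (simp add: leading_exponents_def)
  show ?thesis
    unfolding assms(2)
    by (rule monomial_not_unit_fraction_sum[OF assms(1) l]) (use P(1) in \<open>auto simp: N_def\<close>)
qed

end
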